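(* Let $m\ge 2$ be an integer and let $A(\mathcal{D}_m)$ be as defined in the context. Suppose there exist natural numbers $n_0,a,b$ such that $A(\mathcal{D}_m)^{n_0+a}=b\boxtimes A(\mathcal{D}_m)^{n_0}$. Then $$\gamma_2(P_m\Box C_{n+a})-\gamma_2(P_m\Box C_n)=b$$ for every integer $n\ge n_0$ with $n\ge 3$.
   Context: $P_m$ is the path on $m$ vertices and $C_n$ the cycle on $n$ vertices ($n\ge 3$). The Cartesian product $G\Box H$ has vertex set $V(G)\times V(H)$, with $(g_1,h_1)\sim(g_2,h_2)$ iff either $g_1=g_2$ and $h_1h_2\in E(H)$, or $g_1g_2\in E(G)$ and $h_1=h_2$. A $2$-dominating set of a graph $G$ is a set $S\subseteq V(G)$ such that every vertex not in $S$ has at least two neighbours in $S$; $\gamma_2(G)$ is the minimum cardinality of a $2$-dominating set. A correct $m$-word is a word $p=(p_1,\dots,p_m)$ over $\{0,1,2\}$ that contains none of $020,111,211,112,212$ as a block of consecutive letters, whose first two letters are neither $11$ nor $12$, and whose last two letters are neither $11$ nor $21$. For correct $m$-words $q,p$, say $p$ can follow $q$ if for every $i$: (i) $q_i=2$ implies $p_i=0$; (ii) $p_i=2$ implies exactly one of $p_{i-1},p_{i+1},q_i$ equals $0$; (iii) $p_i=1$ implies at least two of $p_{i-1},p_{i+1},q_i$ equal $0$; letters with index $0$ or $m+1$ are omitted from these lists. $\mathcal{D}_m$ is the digraph on the correct $m$-words with an arc $q\to p$ iff $p$ can follow $q$. $A(\mathcal{D}_m)$ is the matrix indexed by correct $m$-words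 with $A(\mathcal{D}_m)_{qp}$ equal to the number of zeros of $p$ if $q\to p$ is an arc, and $\infty$ otherwise. Matrices are over the tropical semiring $(\mathbb{R}\cup\{\infty\},\min,+)$: $(A\boxtimes B)_{ij}=\min_k(a_{ik}+b_{kj})$, $M^k$ is the $k$-fold $(\min,+)$ product, and for a scalar $\alpha$, $(\alpha\boxtimes A)_{ij}=\alpha+a_{ij}$. *)

theory Defs
  imports
    "HOL-Library.Sublist"
    "HOL-Library.Extended_Real"
    "Graph_Theory.Pair_Digraph"
begin

(* An undirected graph is given by a symmetric, loop-free arc relation (locale pair_graph);
   the lemmas below confirm this for the graphs used here. *)

definition path_graph :: "nat \<Rightarrow> nat pair_pre_digraph" where
  "path_graph m = \<lparr> pverts = {..<m},
     parcs = {(i, j). i < m \<and> j < m \<and> (j = i + 1 \<or> i = j + 1)} \<rparr>"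

definition cycle_graph :: "nat \<Rightarrow> nat pair_pre_digraph" where
  "cycle_graph n = \<lparr> pverts = {..<n},
     parcs = {(i, j). i < n \<and> j < n \<and> (j = (i + 1) mod n \<or> i = (j + 1) mod n)} \<rparr>"

definition cart_prod ::
    "'a pair_pre_digraph \<Rightarrow> 'b pair_pre_digraph \<Rightarrow> ('a \<times> 'b) pair_pre_digraph"
    (infixr "\<box>" 70) where
  "G \<box> H = \<lparr> pverts = pverts G \<times> pverts H,
     parcs = {((g1, h1), (g2, h2)).
        (g1 \<in> pverts G \<and> g1 = g2 \<and> (h1, h2) \<in> parcs H) \<or>
        ((g1, g2) \<in> parcs G \<and> h1 \<in> pverts H \<and> h1 = h2)} \<rparr>"

lemma pair_graph_path: "pair_graph (path_graph m)"
proof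
  show "finite (parcs (path_graph m))"
    by (rule finite_subset[of _ "{..<m} \<times> {..<m}"]) (auto simp: path_graph_def)
qed (auto simp: path_graph_def symmetric_def sym_def)

lemma pair_graph_cycle:
  assumes "n \<ge> 3"
  shows "pair_graph (cycle_graph n)"
proof
  show "finite (parcs (cycle_graph n))"
    by (rule finite_subset[of _ "{..<n} \<times> {..<n}"]) (auto simp: cycle_graph_def)
next
  have "i \<noteq> Suc i mod n" if "i < n" for i
    using assms that by (cases "Suc i = n") auto
  then show "\<And>e. e \<in> parcs (cycle_graph n) \<Longrightarrow> fst e \<noteq> snd e"
    by (fastforce simp: cycle_graph_def)
qed (auto simp: cycle_graph_def symmetric_def sym_def)

lemma pair_graph_cart_prod:
  assumes "pair_graph G" and "pair_graph H"
  shows "pair_graph (G \<box> H)"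
proof -
  interpret G: pair_graph G by fact
  interpret H: pair_graph H by fact
  show ?thesis
  proof
    show fin: "finite (pverts (G \<box> H))"
      by (simp add: cart_prod_def)
    show "finite (parcs (G \<box> H))"
      by (rule finite_subset[OF _ finite_cartesian_product[OF fin fin]])
         (auto simp: cart_prod_def dest: G.wellformed' H.wellformed')
    show "symmetric (with_proj (G \<box> H))"
      using G.pair_sym_arcs H.pair_sym_arcs
      by (auto simp: symmetric_def sym_def cart_prod_def)
  qed (auto simp: cart_prod_def dest: G.wellformed' H.wellformed' G.pair_no_loops H.pair_no_loops)
qed

definition two_dominating :: "'a pair_pre_digraph \<Rightarrow> 'a set \<Rightarrow> bool" where
  "two_dominating G S \<longleftrightarrow> S \<subseteq> pverts G \<and>
     (\<forall>v \<in> pverts G - S. card {u \<in> S. (v, u) \<in> parcs G} \<ge> 2)"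

(* Meaningful for finite G, where Min ranges over a finite set containing card (pverts G). *)
definition gamma2 :: "'a pair_pre_digraph \<Rightarrow> nat" where
  "gamma2 G = Min (card ` {S. two_dominating G S})"

definition correct_words :: "nat \<Rightarrow> nat list set" where
  "correct_words m = {p. length p = m \<and> set p \<subseteq> {0, 1, 2} \<and>
     (\<forall>w \<in> {[0,2,0], [1,1,1], [2,1,1], [1,1,2], [2,1,2]}. \<not> sublist w p) \<and>
     (\<forall>w \<in> {[1,1], [1,2]}. \<not> prefix w p) \<and>
     (\<forall>w \<in> {[1,1], [2,1]}. \<not> suffix w p)}"

(* Number of zeros in the list p(i-1), p(i+1), q(i), out-of-range entries being omitted.
   Letters are indexed from 0. *)
definition zero_nbrs :: "nat list \<Rightarrow> nat list \<Rightarrow> nat \<Rightarrow> nat" where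
  "zero_nbrs q p i =
     of_bool (i > 0 \<and> p ! (i - 1) = 0) +
     of_bool (i + 1 < length p \<and> p ! (i + 1) = 0) +
     of_bool (q ! i = 0)"

definition can_follow :: "nat list \<Rightarrow> nat list \<Rightarrow> bool" where
  "can_follow p q \<longleftrightarrow> (\<forall>i < length p.
     (q ! i = 2 \<longrightarrow> p ! i = 0) \<and>
     (p ! i = 2 \<longrightarrow> zero_nbrs q p i = 1) \<and>
     (p ! i = 1 \<longrightarrow> zero_nbrs q p i \<ge> 2))"

definition word_digraph :: "nat \<Rightarrow> nat list pair_pre_digraph" where
  "word_digraph m = \<lparr> pverts = correct_words m,
     parcs = {(q, p). q \<in> correct_words m \<and> p \<in> correct_words m \<and> can_follow p q} \<rparr>"

(* Tropical matrices are functions on an explicit finite index set I.  The entries are extended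
   reals; on the subset excluding -\<infinity>, min and + are the operations of the tropical semiring,
   and all matrices below have entries in that subset. *)
type_synonym 'i trop_matrix = "'i \<Rightarrow> 'i \<Rightarrow> ereal"

definition trop_mult :: "'i set \<Rightarrow> 'i trop_matrix \<Rightarrow> 'i trop_matrix \<Rightarrow> 'i trop_matrix" where
  "trop_mult I A B = (\<lambda>i j. MIN k\<in>I. A i k + B k j)"

(* The empty product is the tropical identity: 0 on the diagonal, \<infinity> elsewhere. *)
primrec trop_power :: "'i set \<Rightarrow> 'i trop_matrix \<Rightarrow> nat \<Rightarrow> 'i trop_matrix" where
  "trop_power I M 0 = (\<lambda>i j. if i = j then 0 else \<infinity>)"
| "trop_power I M (Suc k) = trop_mult I (trop_power I M k) M"

definition trop_scale :: "ereal \<Rightarrow> 'i trop_matrix \<Rightarrow> 'i trop_matrix" where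
  "trop_scale \<alpha> A = (\<lambda>i j. \<alpha> + A i j)"

definition trop_matrix_eq :: "'i set \<Rightarrow> 'i trop_matrix \<Rightarrow> 'i trop_matrix \<Rightarrow> bool" where
  "trop_matrix_eq I A B \<longleftrightarrow> (\<forall>i\<in>I. \<forall>j\<in>I. A i j = B i j)"

definition word_matrix :: "nat \<Rightarrow> nat list trop_matrix" where
  "word_matrix m = (\<lambda>q p. if (q, p) \<in> parcs (word_digraph m)
     then ereal (real (count_list p 0)) else \<infinity>)"

lemma finite_correct_words: "finite (correct_words m)"
  by (rule finite_subset[OF _ finite_lists_length_eq[of "{0, 1, 2}" m]])
     (auto simp: correct_words_def)

lemma replicate_zero_in_correct_words: "replicate m 0 \<in> correct_words m"
  by (auto simp: correct_words_def dest!: set_mono_sublist set_mono_prefix set_mono_suffix)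

lemma trop_power_word_matrix_not_MInfty:
  assumes "i \<in> correct_words m" and "j \<in> correct_words m"
  shows "trop_power (correct_words m) (word_matrix m) k i j \<noteq> -\<infinity>"
  using assms(2)
proof (induction k arbitrary: j)
  case (Suc k)
  let ?f = "\<lambda>l. trop_power (correct_words m) (word_matrix m) k i l + word_matrix m l j"
  have "Min (?f ` correct_words m) \<in> ?f ` correct_words m"
    using finite_correct_words replicate_zero_in_correct_words by (intro Min_in) auto
  then show ?case
    using Suc.IH by (auto simp: trop_mult_def word_matrix_def)
qed simp

end

theory Submission
  imports Defs
begin

text \<open>
  In a 2-dominating set S of P_m \<box> C_n, mark each vertex of S by 0, and a vertex outside S by 1
  or 2 according to whether at least two, or exactly one, of its neighbours in its own and the
  preceding column lie in S; in the latter case the vertex in the next column must lie in S.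
  Reading the columns cyclically turns S into a closed walk of length n in the word digraph, the
  weight of the walk being the cardinality of S, and each closed walk arises in this way. Hence
  the 2-domination number is the tropical trace of the n-th power of the word matrix. Multiplying
  the hypothesis by further powers of the matrix shows that this trace grows by b when n grows by a.
\<close>

section \<open>Tropical powers and walks\<close>

text \<open>Each tropical product is a minimum over the intermediate index, and the walk supplies
  one candidate for it.\<close>

lemma trop_power_le_walk:
  assumes "finite I" and "\<And>t. t \<le> k \<Longrightarrow> w t \<in> I"
  shows "trop_power I M k (w 0) (w k) \<le> (\<Sum>t<k. M (w t) (w (Suc t)))"
  using assms(2)
proof (induction k)
  case (Suc k)
  have "trop_power I M (Suc k) (w 0) (w (Suc k))
      \<le> trop_power I M k (w 0) (w k) + M (w k) (w (Suc k))"
    using assms(1) Suc.prems by (auto simp: trop_mult_def intro!: Min_le)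
  also have "\<dots> \<le> (\<Sum>t<k. M (w t) (w (Suc t))) + M (w k) (w (Suc k))"
    using Suc by (intro add_right_mono) simp
  finally show ?case by simp
qed simp

text \<open>Minimisers of the successive products, read backwards from \<open>j\<close>, trace out
  an optimal walk. For \<open>k = 0\<close> a finite entry forces \<open>i = j\<close>, so the
  constant walk serves.\<close>

lemma trop_power_attained:
  assumes "finite I" and "I \<noteq> {}" and "i \<in> I" and "j \<in> I"
    and "trop_power I M k i j \<noteq> \<infinity>"
  shows "\<exists>w. w 0 = i \<and> w k = j \<and> (\<forall>t\<le>k. w t \<in> I) \<and>
    trop_power I M k i j = (\<Sum>t<k. M (w t) (w (Suc t)))"
  using assms(4,5)
proof (induction k arbitrary: j)
  case 0
  then show ?case by (intro exI[of _ "\<lambda>_. i"]) (auto split: if_splits)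
next
  case (Suc k)
  let ?f = "\<lambda>l. trop_power I M k i l + M l j"
  have "Min (?f ` I) \<in> ?f ` I"
    using assms(1,2) by (intro Min_in) auto
  then obtain l where l: "l \<in> I" "trop_power I M (Suc k) i j = ?f l"
    by (auto simp: trop_mult_def)
  with Suc.prems have "trop_power I M k i l \<noteq> \<infinity>" by auto
  from Suc.IH[OF l(1) this] obtain w where w: "w 0 = i" "w k = l" "\<forall>t\<le>k. w t \<in> I"
    "trop_power I M k i l = (\<Sum>t<k. M (w t) (w (Suc t)))" by blast
  have "(\<Sum>t<k. M ((w(Suc k := j)) t) ((w(Suc k := j)) (Suc t))) = (\<Sum>t<k. M (w t) (w (Suc t)))"
    by (intro sum.cong) auto
  then show ?case
    using w l Suc.prems(1) by (intro exI[of _ "w(Suc k := j)"]) (auto simp: le_Suc_eq)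
qed

text \<open>Translation is monotone on \<open>ereal\<close>, infinite values included, and monotone
  maps commute with minima of finite nonempty sets.\<close>

lemma Min_ereal_add_const:
  fixes f :: "'a \<Rightarrow> ereal"
  assumes "finite I" and "I \<noteq> {}"
  shows "(MIN i\<in>I. c + f i) = c + (MIN i\<in>I. f i)"
proof -
  have "mono (\<lambda>x::ereal. c + x)"
    by (intro monoI add_left_mono)
  from mono_Min_commute[OF this, of "f ` I"] show ?thesis
    using assms by (simp add: image_image)
qed

text \<open>Right multiplication by \<open>M\<close> commutes with tropical scaling and reads only
  entries indexed by \<open>I\<close>, so the relation persists when both exponents grow
  equally.\<close>

lemma trop_power_scale_shift:
  assumes "finite I" and "I \<noteq> {}"
    and "trop_matrix_eq I (trop_power I M r) (trop_scale c (trop_power I M s))"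
  shows "trop_matrix_eq I (trop_power I M (r + k)) (trop_scale c (trop_power I M (s + k)))"
proof (induction k)
  case (Suc k)
  have "trop_power I M (r + Suc k) i j = c + trop_power I M (s + Suc k) i j"
    if "i \<in> I" "j \<in> I" for i j
  proof -
    have "(MIN l\<in>I. trop_power I M (r + k) i l + M l j)
        = (MIN l\<in>I. c + (trop_power I M (s + k) i l + M l j))"
      using Suc that
      by (intro arg_cong[of _ _ Min] image_cong)
         (auto simp: trop_matrix_eq_def trop_scale_def add.assoc)
    then show ?thesis
      using Min_ereal_add_const[OF assms(1,2)] by (simp add: trop_mult_def)
  qed
  then show ?case by (simp add: trop_matrix_eq_def trop_scale_def)
qed (use assms in simp)

section \<open>Two-dominating sets as closed walks\<close>

definition zero_set :: "nat \<Rightarrow> nat \<Rightarrow> (nat \<Rightarrow> nat list) \<Rightarrow> (nat \<times> nat) set" where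
  "zero_set m n w = {(i, j). i < m \<and> j < n \<and> w j ! i = 0}"

text \<open>Only the columns below \<open>n\<close> are constrained; \<open>w n = w 0\<close> has to
  be required separately where consecutive indices are used without reduction.\<close>

definition closed_walk :: "nat \<Rightarrow> nat \<Rightarrow> (nat \<Rightarrow> nat list) \<Rightarrow> bool" where
  "closed_walk m n w \<longleftrightarrow> (\<forall>j<n. (w j, w (Suc j mod n)) \<in> parcs (word_digraph m))"

lemma pverts_grid: "pverts (path_graph m \<box> cycle_graph n) = {..<m} \<times> {..<n}"
  by (simp add: cart_prod_def path_graph_def cycle_graph_def)

text \<open>Solves the second disjunct of cycle adjacency for the neighbour. Adding \<open>n\<close>
  first avoids truncated subtraction at \<open>j = 0\<close>.\<close>

lemma cyclic_pred_eq_iff: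
  assumes "j < n" and "l < n"
  shows "j = Suc l mod n \<longleftrightarrow> l = (j + n - 1) mod n"
  using assms by (cases "Suc l = n"; cases j) auto

lemma cyclic_succ_neq_pred:
  assumes "n \<ge> 3" and "j < n"
  shows "Suc j mod n \<noteq> (j + n - 1) mod n"
  using assms by (cases "Suc j = n"; cases j) auto

text \<open>The bridge from graph to words: \<open>zero_nbrs\<close> sees the neighbours within the
  column and in the preceding column, which leaves only the one in the next column. For
  \<open>n \<ge> 3\<close> the preceding and next columns differ, so nothing is counted
  twice.\<close>

lemma card_zero_set_nbrs:
  assumes n: "n \<ge> 3" and i: "i < m" and j: "j < n" and len: "length (w j) = m"
  shows "card {u \<in> zero_set m n w. ((i, j), u) \<in> parcs (path_graph m \<box> cycle_graph n)}
    = zero_nbrs (w ((j + n - 1) mod n)) (w j) i + of_bool (w (Suc j mod n) ! i = 0)"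
proof -
  define p s where "p = (j + n - 1) mod n" and "s = Suc j mod n"
  have ps: "p < n" "s < n" "s \<noteq> p" "p \<noteq> j" "s \<noteq> j"
    using n j cyclic_succ_neq_pred[OF n j]
    by (auto simp: p_def s_def mod_if split: if_splits)
  \<comment> \<open>One set of size at most one per potential neighbour; their cardinalities are the
    summands of the claim.\<close>
  let ?A = "if i > 0 \<and> w j ! (i - 1) = 0 then {(i - 1, j)} else {}"
  let ?B = "if i + 1 < m \<and> w j ! (i + 1) = 0 then {(i + 1, j)} else {}"
  let ?C = "if w p ! i = 0 then {(i, p)} else {}"
  let ?D = "if w s ! i = 0 then {(i, s)} else {}"
  have arc: "((i, j), (k, l)) \<in> parcs (path_graph m \<box> cycle_graph n) \<longleftrightarrow>
      (k = i \<and> l < n \<and> (l = s \<or> l = p)) \<or> (l = j \<and> k < m \<and> (k = i + 1 \<or> i = k + 1))" for k l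
    using i j cyclic_pred_eq_iff[OF j, of l]
    by (auto simp: cart_prod_def path_graph_def cycle_graph_def p_def s_def)
  have "{u \<in> zero_set m n w. ((i, j), u) \<in> parcs (path_graph m \<box> cycle_graph n)}
      = {(k, l). k < m \<and> l < n \<and> w l ! k = 0 \<and>
          ((k = i \<and> (l = s \<or> l = p)) \<or> (l = j \<and> (k = i + 1 \<or> i = k + 1)))}"
    by (intro set_eqI) (simp add: zero_set_def split_paired_all arc, blast)
  also have "\<dots> = (?A \<union> ?B) \<union> (?C \<union> ?D)"
    using i j ps by (auto split: if_splits)
  also have "card \<dots> = (card ?A + card ?B) + (card ?C + card ?D)"
    using ps by (subst card_Un_disjoint; (subst card_Un_disjoint)?; auto)+
  finally show ?thesis
    by (simp add: zero_nbrs_def len p_def s_def)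
qed

lemma two_dominating_zero_set:
  assumes n: "n \<ge> 3" and w: "closed_walk m n w"
  shows "two_dominating (path_graph m \<box> cycle_graph n) (zero_set m n w)"
  unfolding two_dominating_def
proof (intro conjI ballI)
  show "zero_set m n w \<subseteq> pverts (path_graph m \<box> cycle_graph n)"
    by (auto simp: zero_set_def pverts_grid)
next
  fix v assume v: "v \<in> pverts (path_graph m \<box> cycle_graph n) - zero_set m n w"
  obtain i j where [simp]: "v = (i, j)" by (cases v)
  from v have ij: "i < m" "j < n" and nz: "w j ! i \<noteq> 0"
    by (auto simp: pverts_grid zero_set_def)
  define p where "p = (j + n - 1) mod n"
  have p: "p < n" "Suc p mod n = j"
    using ij cyclic_pred_eq_iff[OF ij(2), of p] by (auto simp: p_def)
  have prev: "can_follow (w j) (w p)" and cw: "w j \<in> correct_words m"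
    using w p unfolding closed_walk_def word_digraph_def by auto
  have succ: "can_follow (w (Suc j mod n)) (w j)" "w (Suc j mod n) \<in> correct_words m"
    using w ij unfolding closed_walk_def word_digraph_def by auto
  have len: "length (w j) = m" "length (w (Suc j mod n)) = m"
    using cw succ by (auto simp: correct_words_def)
  have "w j ! i \<in> set (w j)" using len ij by simp
  then have "w j ! i \<in> {0, 1, 2}" using cw unfolding correct_words_def by blast
  then consider "w j ! i = 1" | "w j ! i = 2" using nz by auto
  \<comment> \<open>A letter 1 already has two zeros in \<open>zero_nbrs\<close>; a letter 2 has one
    there and forces a zero in the next column.\<close>
  then have "zero_nbrs (w p) (w j) i + of_bool (w (Suc j mod n) ! i = 0) \<ge> 2"
    using prev succ(1) len ij unfolding can_follow_def by cases auto
  then show "2 \<le> card {u \<in> zero_set m n w. (v, u) \<in> parcs (path_graph m \<box> cycle_graph n)}"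
    using card_zero_set_nbrs[where w = w, OF n ij len(1)] by (simp add: p_def)
qed

text \<open>Every forbidden block violates the following condition at one letter: the 2 in 020 sees
  two zeros, while a 1 with no zero beside it in its own word sees at most the zero of
  \<open>q\<close>.\<close>

lemma can_follow_imp_correct_word:
  assumes len: "length p = m" and m: "m \<ge> 2" and set: "set p \<subseteq> {0, 1, 2}"
    and cf: "can_follow p q"
  shows "p \<in> correct_words m"
proof -
  have "\<not> sublist [x, y, z] p"
    if xyz: "[x, y, z] \<in> {[0,2,0], [1,1,1], [2,1,1], [1,1,2], [2,1,2]}" for x y z
  proof
    assume "sublist [x, y, z] p"
    then obtain u v where p: "p = u @ [x, y, z] @ v" by (auto simp: sublist_def)
    have "p ! length u = x" "p ! (length u + 1) = y" "p ! (length u + 2) = z"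
      by (simp_all add: p nth_append)
    then show False
      \<comment> \<open>Position of the middle letter of the block.\<close>
      using cf[unfolded can_follow_def, rule_format, of "length u + 1"] xyz
      by (auto simp: p nth_append zero_nbrs_def of_bool_def split: if_splits)
  qed
  moreover have "\<not> prefix [x, y] p" if "[x, y] \<in> {[1,1], [1,2]}" for x y
    using cf[unfolded can_follow_def, rule_format, of 0] that
    by (auto simp: prefix_def zero_nbrs_def of_bool_def split: if_splits)
  moreover have "\<not> suffix [x, y] p" if xy: "[x, y] \<in> {[1,1], [2,1]}" for x y
  proof
    assume "suffix [x, y] p"
    then obtain u where p: "p = u @ [x, y]" by (auto simp: suffix_def)
    have "p ! length u = x" "p ! (length u + 1) = y"
      by (simp_all add: p nth_append)
    then show False
      \<comment> \<open>Position of the last letter of the word, which is 1 in both forbidden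
        suffixes.\<close>
      using cf[unfolded can_follow_def, rule_format, of "length u + 1"] xy
      by (auto simp: p nth_append zero_nbrs_def of_bool_def split: if_splits)
  qed
  ultimately show ?thesis
    using len set by (auto simp: correct_words_def)
qed

lemma two_dominating_obtain_walk:
  assumes m: "m \<ge> 2" and n: "n \<ge> 3"
    and S: "two_dominating (path_graph m \<box> cycle_graph n) S"
  obtains w where "closed_walk m n w" and "zero_set m n w = S"
proof -
  let ?G = "path_graph m \<box> cycle_graph n"
  define d where "d = (\<lambda>i j. card {u \<in> S. ((i, j), u) \<in> parcs ?G})"
  \<comment> \<open>Letter 2 marks exactly two neighbours in \<open>S\<close>, one of them in the
    next column, hence one in \<open>zero_nbrs\<close>. For letter 1, either the next column
    contributes nothing or there are at least three neighbours in \<open>S\<close>; both leave at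
    least two in \<open>zero_nbrs\<close>.\<close>
  define w where "w = (\<lambda>j. map (\<lambda>i. if (i, j) \<in> S then 0
    else if (i, Suc j mod n) \<in> S \<and> d i j = 2 then 2 else 1 :: nat) [0..<m])"
  have len: "length (w j) = m" for j by (simp add: w_def)
  have nth: "w j ! i = (if (i, j) \<in> S then 0
    else if (i, Suc j mod n) \<in> S \<and> d i j = 2 then 2 else 1)" if "i < m" for i j
    using that by (simp add: w_def)
  have zs: "zero_set m n w = S"
    using S by (auto simp: zero_set_def nth two_dominating_def pverts_grid split: if_splits)
  have nbrs: "d i j = zero_nbrs (w ((j + n - 1) mod n)) (w j) i + of_bool ((i, Suc j mod n) \<in> S)"
    if "i < m" "j < n" for i j
    using card_zero_set_nbrs[where w = w, OF n that len] nth[OF that(1)] by (simp add: d_def zs)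
  have dom: "d i j \<ge> 2" if "i < m" "j < n" "(i, j) \<notin> S" for i j
    using S that by (auto simp: two_dominating_def pverts_grid d_def)
  have cf: "can_follow (w (Suc j mod n)) (w j)" if j: "j < n" for j
    unfolding can_follow_def len
  proof (intro allI impI)
    fix i assume i: "i < m"
    let ?s = "Suc j mod n"
    \<comment> \<open>The degree count is applied at column \<open>?s\<close>, whose preceding
      column is \<open>j\<close>.\<close>
    have s: "?s < n" and ps: "(?s + n - 1) mod n = j"
      using j cyclic_pred_eq_iff[of ?s n j] by auto
    note N = nbrs[OF i s, unfolded ps]
    show "(w j ! i = 2 \<longrightarrow> w ?s ! i = 0) \<and>
        (w ?s ! i = 2 \<longrightarrow> zero_nbrs (w j) (w ?s) i = 1) \<and>
        (w ?s ! i = 1 \<longrightarrow> 2 \<le> zero_nbrs (w j) (w ?s) i)"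
      using N dom[OF i s] by (auto simp: nth[OF i] split: if_splits)
  qed
  have cw: "w j \<in> correct_words m" if j: "j < n" for j
  proof (rule can_follow_imp_correct_word[OF len m])
    show "set (w j) \<subseteq> {0, 1, 2}" by (auto simp: w_def)
    \<comment> \<open>Each column follows its cyclic predecessor, which yields correctness of its
      word.\<close>
    have "(j + n - 1) mod n < n" "Suc ((j + n - 1) mod n) mod n = j"
      using j cyclic_pred_eq_iff[of j n "(j + n - 1) mod n"] by auto
    then show "can_follow (w j) (w ((j + n - 1) mod n))" using cf by metis
  qed
  have "closed_walk m n w"
    using cf cw n by (auto simp: closed_walk_def word_digraph_def)
  with zs show ?thesis using that by blast
qed

section \<open>Weights of closed walks\<close>

lemma card_zero_set:
  assumes "\<And>j. j < n \<Longrightarrow> length (w j) = m"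
  shows "card (zero_set m n w) = (\<Sum>j<n. count_list (w j) 0)"
proof -
  \<comment> \<open>Coordinates are swapped so that the count runs column by column.\<close>
  have "zero_set m n w = (\<lambda>(j, i). (i, j)) ` (SIGMA j:{..<n}. {i. i < m \<and> w j ! i = 0})"
    by (auto simp: zero_set_def)
  then have "card (zero_set m n w) = card (SIGMA j:{..<n}. {i. i < m \<and> w j ! i = 0})"
    by (simp add: card_image inj_on_def split_beta prod_eq_iff)
  also have "\<dots> = (\<Sum>j<n. card {i. i < m \<and> w j ! i = 0})"
    by (simp add: card_SigmaI)
  also have "\<dots> = (\<Sum>j<n. count_list (w j) 0)"
    using assms
    by (intro sum.cong)
       (auto simp: count_list_eq_length_filter length_filter_conv_card eq_commute[of 0])
  finally show ?thesis .
qed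

lemma sum_shift_cyclic:
  fixes f :: "nat \<Rightarrow> 'a::comm_monoid_add"
  assumes "f n = f 0"
  shows "(\<Sum>t<n. f (Suc t)) = (\<Sum>t<n. f t)"
proof (cases n)
  case (Suc k)
  have "(\<Sum>t<Suc k. f (Suc t)) = (\<Sum>t<k. f (Suc t)) + f 0"
    using assms Suc by simp
  also have "\<dots> = (\<Sum>t<Suc k. f t)"
    by (subst sum.lessThan_Suc_shift) (simp add: add.commute)
  finally show ?thesis by (simp add: Suc)
qed simp

text \<open>An arc is weighted by the zeros of its head, so the walk sums over columns 1 to
  \<open>n\<close>; a cyclic shift turns this into columns 0 to \<open>n - 1\<close>.\<close>

lemma walk_weight:
  assumes w: "closed_walk m n w" and "w n = w 0"
  shows "(\<Sum>t<n. word_matrix m (w t) (w (Suc t))) = ereal (real (card (zero_set m n w)))"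
proof -
  have arc: "(w t, w (Suc t)) \<in> parcs (word_digraph m)" if "t < n" for t
    using w that assms(2) unfolding closed_walk_def
    by (cases "Suc t = n") (auto dest!: spec[of _ t])
  have "length (w t) = m" if "t < n" for t
    using arc[OF that] by (simp add: word_digraph_def correct_words_def)
  then have "card (zero_set m n w) = (\<Sum>t<n. count_list (w (Suc t)) 0)"
    using card_zero_set[of n w m] sum_shift_cyclic[of "\<lambda>t. count_list (w t) 0" n] assms(2) by simp
  moreover have "(\<Sum>t<n. word_matrix m (w t) (w (Suc t)))
      = (\<Sum>t<n. ereal (real (count_list (w (Suc t)) 0)))"
    using arc by (intro sum.cong) (auto simp: word_matrix_def)
  ultimately show ?thesis by simp
qed

text \<open>Two inequalities: a minimum 2-dominating set yields a closed walk bounding the trace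
  from above, and an optimal closed walk yields a 2-dominating set of that weight.\<close>

lemma gamma2_eq_trop_trace:
  assumes m: "m \<ge> 2" and n: "n \<ge> 3"
  shows "ereal (real (gamma2 (path_graph m \<box> cycle_graph n))) =
    (MIN q\<in>correct_words m. trop_power (correct_words m) (word_matrix m) n q q)"
    (is "ereal (real (gamma2 ?G)) = Min (?T ` ?I)")
proof -
  have fin: "finite {S. two_dominating ?G S}"
    by (rule finite_subset[of _ "Pow ({..<m} \<times> {..<n})"])
       (auto simp: two_dominating_def pverts_grid)
  have ne: "two_dominating ?G (pverts ?G)" by (simp add: two_dominating_def)
  have I: "finite ?I" "?I \<noteq> {}"
    using finite_correct_words replicate_zero_in_correct_words by auto
  have "gamma2 ?G \<in> card ` {S. two_dominating ?G S}"
    unfolding gamma2_def using fin ne by (intro Min_in) auto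
  then obtain S where S: "two_dominating ?G S" "gamma2 ?G = card S" by auto
  obtain w where w: "closed_walk m n w" "zero_set m n w = S"
    using two_dominating_obtain_walk[OF m n S(1)] .
  \<comment> \<open>Periodic extension, making \<open>v n = v 0\<close> hold.\<close>
  define v where "v = (\<lambda>t. w (t mod n))"
  have v: "closed_walk m n v" "zero_set m n v = S" "v n = v 0"
    using w n by (auto simp: v_def closed_walk_def zero_set_def)
  have vI: "v t \<in> ?I" for t
    using w(1) n by (auto simp: v_def closed_walk_def word_digraph_def)
  have "Min (?T ` ?I) \<le> ?T (v 0)"
    using I vI by (intro Min_le) auto
  also have "\<dots> \<le> (\<Sum>t<n. word_matrix m (v t) (v (Suc t)))"
    using trop_power_le_walk[OF I(1), of n v] vI v(3) by simp
  also have "\<dots> = ereal (real (gamma2 ?G))"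
    using walk_weight[OF v(1,3)] v(2) S(2) by simp
  finally have le: "Min (?T ` ?I) \<le> ereal (real (gamma2 ?G))" .
  have "Min (?T ` ?I) \<in> ?T ` ?I" using I by (intro Min_in) auto
  then obtain q where q: "q \<in> ?I" "Min (?T ` ?I) = ?T q" by auto
  \<comment> \<open>The first inequality bounds the minimum by a real number.\<close>
  then have fq: "?T q \<noteq> \<infinity>" using le by auto
  obtain u where u: "u 0 = q" "u n = q" "\<forall>t\<le>n. u t \<in> ?I"
    "?T q = (\<Sum>t<n. word_matrix m (u t) (u (Suc t)))"
    using trop_power_attained[OF I q(1) q(1) fq] by blast
  \<comment> \<open>A finite total weight excludes infinite summands, so every step is a genuine
    arc.\<close>
  have "word_matrix m (u t) (u (Suc t)) \<noteq> \<infinity>" if "t < n" for t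
    using fq that unfolding u(4) sum_Pinfty by auto
  then have "(u t, u (Suc t)) \<in> parcs (word_digraph m)" if "t < n" for t
    using that by (metis word_matrix_def)
  then have cu: "closed_walk m n u"
    unfolding closed_walk_def using u(1,2) by (metis Suc_lessI mod_less mod_self)
  have "gamma2 ?G \<le> card (zero_set m n u)"
    unfolding gamma2_def using fin two_dominating_zero_set[OF n cu] by (intro Min_le) auto
  then have "ereal (real (gamma2 ?G)) \<le> Min (?T ` ?I)"
    using walk_weight[OF cu] u q(2) by simp
  with le show ?thesis by simp
qed

theorem theorem4:
  fixes m n0 a b :: nat
  assumes "m \<ge> 2"
    and "trop_matrix_eq (correct_words m)
           (trop_power (correct_words m) (word_matrix m) (n0 + a))
           (trop_scale (ereal (real b)) (trop_power (correct_words m) (word_matrix m) n0))"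
  shows "\<forall>n::nat. n \<ge> n0 \<and> n \<ge> 3 \<longrightarrow>
           int (gamma2 (path_graph m \<box> cycle_graph (n + a)))
             - int (gamma2 (path_graph m \<box> cycle_graph n)) = int b"
proof (intro allI impI)
  fix n :: nat
  assume n: "n \<ge> n0 \<and> n \<ge> 3"
  let ?I = "correct_words m" and ?P = "trop_power (correct_words m) (word_matrix m)"
  let ?g = "\<lambda>n. gamma2 (path_graph m \<box> cycle_graph n)"
  have I: "finite ?I" "?I \<noteq> {}"
    using finite_correct_words replicate_zero_in_correct_words by auto
  \<comment> \<open>Multiplication by the power \<open>n - n0\<close> lifts the hypothesis from
    \<open>n0\<close> to \<open>n\<close>; only its diagonal is used below.\<close>
  have "trop_matrix_eq ?I (?P (n + a)) (trop_scale (ereal (real b)) (?P n))"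
    using trop_power_scale_shift[OF I assms(2), of "n - n0"] n by (simp add: add.commute)
  then have "(MIN q\<in>?I. ?P (n + a) q q) = (MIN q\<in>?I. ereal (real b) + ?P n q q)"
    by (intro arg_cong[of _ _ Min] image_cong) (auto simp: trop_matrix_eq_def trop_scale_def)
  then have "ereal (real (?g (n + a))) = ereal (real b) + ereal (real (?g n))"
    using gamma2_eq_trop_trace[OF assms(1)] n Min_ereal_add_const[OF I] by simp
  then have "?g (n + a) = b + ?g n" by simp
  then show "int (?g (n + a)) - int (?g n) = int b" by simp
qed

end
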